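(* Let $g\colon[0,1)\to\mathbb{C}$ be a function whose Fourier series converges absolutely. Let the exact integral of $g$ over one period be $c_0(g)$. The numerical approximation by the midpoint rule with $M\in\mathbb{N}$ equispaced subintervals is given by $$I_M(g)=\frac1M\sum_{j=1}^M g\left(\frac{2j-1}{2M}\right).$$ Then the quadrature error satisfies the identity $$I_M(g)-c_0(g)=\sum_{k\in\mathbb{Z}\setminus\{0\}}(-1)^k\,c_{kM}(g).$$
   Context: The Fourier coefficients of $g$ are $c_k(g)=\int_0^1 g(y)\,\mathrm{e}^{-2\pi\mathrm{i}ky}\,\mathrm{d}y$ for $k\in\mathbb{Z}$, and the Fourier series of $g$ is $\sum_{k\in\mathbb{Z}}c_k(g)\,\mathrm{e}^{2\pi\mathrm{i}ky}$.
   Formalization: The Fourier series of g is assumed not only to converge absolutely but also to equal g at every point of [0,1); without this the identity fails, e.g. for g the indicator function of {1/2} and M = 1, where every Fourier coefficient is 0 but I_1(g) = 1. *)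

theory Defs
  imports "HOL-Analysis.Analysis"
begin

text \<open>A function on \<open>[0,1)\<close> is represented by a total function \<open>g :: real \<Rightarrow> complex\<close>;
  nothing below depends on its values outside \<open>{0..<1}\<close>.\<close>

definition fourier_coeff :: "(real \<Rightarrow> complex) \<Rightarrow> int \<Rightarrow> complex" where
  "fourier_coeff g k =
     (LINT y:{0..<1}|lebesgue. g y * exp (- 2 * complex_of_real pi * \<i> * of_int k * of_real y))"

definition fourier_term :: "(real \<Rightarrow> complex) \<Rightarrow> real \<Rightarrow> int \<Rightarrow> complex" where
  "fourier_term g y k =
     fourier_coeff g k * exp (2 * complex_of_real pi * \<i> * of_int k * of_real y)"

text \<open>That the Fourier series of \<open>g\<close> converges absolutely is understood to include that it
  represents \<open>g\<close> at every point of \<open>[0,1)\<close>. The coefficients only determine \<open>g\<close> up to null sets,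
  whereas the midpoint rule uses point values: the indicator function of \<open>{1/2}\<close> has vanishing
  Fourier coefficients, but its one-point midpoint rule is \<open>1\<close>.\<close>

definition abs_convergent_fourier_series :: "(real \<Rightarrow> complex) \<Rightarrow> bool" where
  "abs_convergent_fourier_series g \<longleftrightarrow>
     g absolutely_integrable_on {0..<1} \<and>
     (\<forall>y\<in>{0..<1}. (\<lambda>k. norm (fourier_term g y k)) summable_on UNIV \<and>
                  (fourier_term g y has_sum g y) UNIV)"

definition midpoint_rule :: "nat \<Rightarrow> (real \<Rightarrow> complex) \<Rightarrow> complex" where
  "midpoint_rule M g =
     1 / of_nat M * (\<Sum>j=1..M. g ((2 * real j - 1) / (2 * real M)))"

end

theory Submission
  imports Defs
begin

text \<open>At the midpoints, the Fourier mode of index \<open>k\<close> takes the values \<open>w, w q, w q\<^sup>2, \<dots>\<close>, where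
  \<open>q = exp (2\<pi>ik/M)\<close> is an \<open>M\<close>-th root of unity and \<open>w = exp (\<pi>ik/M)\<close>. Hence the midpoint rule
  annihilates the mode unless \<open>M\<close> divides \<open>k\<close>, and for \<open>k = m M\<close> it gives \<open>w = (-1)\<^sup>m\<close>. Applying
  the rule to the pointwise Fourier series term by term yields the error identity.\<close>

text \<open>Evaluates every root of unity below: an odd or even \<open>m\<close> gives the sign of
  \<open>w\<close>, and an even exponent gives the value 1 for \<open>q ^ M\<close> and for
  \<open>q\<close>.\<close>

lemma exp_of_int_pi_i: "exp (of_int m * (complex_of_real pi * \<i>)) = (-1) powi m"
  using exp_power_int[of "complex_of_real pi * \<i>" m] by (simp add: mult.commute)

lemma midpoint_rule_exp:
  assumes "M \<ge> 1"
  shows "midpoint_rule M (\<lambda>y. exp (2 * complex_of_real pi * \<i> * of_int k * of_real y)) =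
    (if int M dvd k then (-1) powi (k div int M) else 0)"
proof -
  define w where "w = exp (complex_of_real pi * \<i> * of_int k / of_nat M)"
  define q where "q = exp (2 * complex_of_real pi * \<i> * of_int k / of_nat M)"
  have M: "complex_of_nat M \<noteq> 0"
    using assms by simp
  \<comment> \<open>Shifting to \<open>j = Suc i\<close> turns the node into (2i+1)/(2M): the half
    step 1/(2M) contributes \<open>w\<close>, and each of the \<open>i\<close> full steps 1/M
    contributes a factor \<open>q\<close>.\<close>
  have node: "exp (2 * complex_of_real pi * \<i> * of_int k *
      of_real ((2 * real (Suc i) - 1) / (2 * real M))) = w * q ^ i" for i
    unfolding w_def q_def exp_of_nat_mult[symmetric] exp_add[symmetric]
    by (rule arg_cong[where f = exp]) (use M in \<open>simp add: field_simps\<close>)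
  have "midpoint_rule M (\<lambda>y. exp (2 * complex_of_real pi * \<i> * of_int k * of_real y)) =
      1 / of_nat M * (\<Sum>i<M. w * q ^ i)"
    unfolding midpoint_rule_def
    using sum.atLeast1_atMost_eq[of "\<lambda>j. exp (2 * complex_of_real pi * \<i> * of_int k *
      of_real ((2 * real j - 1) / (2 * real M)))" M]
    by (simp only: node One_nat_def)
  also have "\<dots> = w / of_nat M * (\<Sum>i<M. q ^ i)"
    by (simp add: sum_distrib_left)
  finally have eq: "midpoint_rule M (\<lambda>y. exp (2 * complex_of_real pi * \<i> * of_int k * of_real y)) =
      w / of_nat M * (\<Sum>i<M. q ^ i)" .
  have "q ^ M = exp (of_int (2 * k) * (complex_of_real pi * \<i>))"
    unfolding q_def exp_of_nat_mult[symmetric]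
    by (rule arg_cong[where f = exp]) (use M in \<open>simp add: field_simps\<close>)
  also have "\<dots> = 1"
    unfolding exp_of_int_pi_i by (simp add: power_int_mult)
  finally have qM: "q ^ M = 1" .
  \<comment> \<open>If \<open>q = 1\<close>, the angle 2 pi k/M is an even multiple 2n pi of pi, so
    k = nM.\<close>
  have q1: "int M dvd k" if "q = 1"
  proof -
    obtain n :: int where "2 * pi * of_int k / real M = of_int (2 * n) * pi"
      using \<open>q = 1\<close> unfolding q_def exp_eq_1 by auto
    then have "real_of_int k = of_int (n * int M)"
      using assms by (simp add: field_simps)
    then show ?thesis
      unfolding of_int_eq_iff by simp
  qed
  show ?thesis
  proof (cases "int M dvd k")
    case True
    then obtain m where k: "k = int M * m" ..
    have w: "w = (-1) powi m"
      unfolding w_def exp_of_int_pi_i[symmetric] k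
      by (rule arg_cong[where f = exp]) (use M in \<open>simp add: field_simps\<close>)
    \<comment> \<open>With \<open>q = 1\<close> the geometric sum is \<open>M\<close>, which cancels
      the weight 1/M and leaves \<open>w\<close>.\<close>
    have "q = exp (of_int (2 * m) * (complex_of_real pi * \<i>))"
      unfolding q_def k by (rule arg_cong[where f = exp]) (use M in \<open>simp add: field_simps\<close>)
    also have "\<dots> = 1"
      unfolding exp_of_int_pi_i by (simp add: power_int_mult)
    finally show ?thesis
      using M assms unfolding eq w by (simp add: k)
  next
    case False
    \<comment> \<open>The geometric sum is now (q^M - 1)/(q - 1), whose numerator vanishes by
      \<open>qM\<close>.\<close>
    then have "q \<noteq> 1"
      using q1 by blast
    then show ?thesis
      using False qM unfolding eq by (simp add: geometric_sum)
  qed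
qed

lemma has_sum_sum:
  fixes f :: "'a \<Rightarrow> 'b \<Rightarrow> 'c :: topological_comm_monoid_add"
  assumes "\<And>j. j \<in> J \<Longrightarrow> ((\<lambda>k. f k j) has_sum S j) A"
  shows "((\<lambda>k. \<Sum>j\<in>J. f k j) has_sum (\<Sum>j\<in>J. S j)) A"
  \<comment> \<open>For infinite \<open>J\<close> both finite-sum expressions are 0 by
    convention.\<close>
  using assms by (induction J rule: infinite_finite_induct) (auto intro: has_sum_add has_sum_0)

text \<open>The rule is a finite linear combination of point values, and its nodes lie between
  1/(2M) and 1 - 1/(2M), so pointwise convergence on [0,1) is enough.\<close>

lemma midpoint_rule_has_sum:
  fixes f :: "'a \<Rightarrow> real \<Rightarrow> complex"
  assumes "\<And>y. y \<in> {0..<1} \<Longrightarrow> ((\<lambda>k. f k y) has_sum g y) A"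
  shows "((\<lambda>k. midpoint_rule M (f k)) has_sum midpoint_rule M g) A"
  unfolding midpoint_rule_def
proof (intro has_sum_cmult_right has_sum_sum assms)
  fix j assume "j \<in> {1..M}"
  then have "1 \<le> real j" "real j \<le> real M"
    by auto
  then show "(2 * real j - 1) / (2 * real M) \<in> {0..<1}"
    by (simp add: field_simps)
qed

theorem theorem2p1:
  fixes g :: "real \<Rightarrow> complex" and M :: nat
  assumes "abs_convergent_fourier_series g"
    and "M \<ge> 1"
  shows "((\<lambda>k::int. (-1) powi k * fourier_coeff g (k * int M)) has_sum
          (midpoint_rule M g - fourier_coeff g 0)) (UNIV - {0})"
proof -
  let ?F = "\<lambda>k. if int M dvd k then (-1) powi (k div int M) * fourier_coeff g k else 0"
  let ?G = "\<lambda>k::int. (-1) powi k * fourier_coeff g (k * int M)"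
  have "((\<lambda>k. midpoint_rule M (\<lambda>y. fourier_term g y k)) has_sum midpoint_rule M g) UNIV"
    using assms(1) by (intro midpoint_rule_has_sum) (simp add: abs_convergent_fourier_series_def)
  moreover have "midpoint_rule M (\<lambda>y. fourier_term g y k) = ?F k" for k
  proof -
    have "midpoint_rule M (\<lambda>y. fourier_term g y k) = fourier_coeff g k *
        midpoint_rule M (\<lambda>y. exp (2 * complex_of_real pi * \<i> * of_int k * of_real y))"
      unfolding midpoint_rule_def fourier_term_def sum_distrib_left[symmetric]
      by (simp only: mult.left_commute)
    then show ?thesis
      unfolding midpoint_rule_exp[OF assms(2)] by simp
  qed
  ultimately have "(?F has_sum midpoint_rule M g) UNIV"
    by simp
  \<comment> \<open>\<open>?F\<close> vanishes off the multiples of \<open>M\<close>, and k -> kM is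
    injective for positive \<open>M\<close>, so the sum can be reindexed by the quotient.\<close>
  also have "?this \<longleftrightarrow> (?F has_sum midpoint_rule M g) (range (\<lambda>k. k * int M))"
    by (rule has_sum_cong_neutral) (auto simp: dvd_def mult.commute)
  also have "\<dots> \<longleftrightarrow> ((?F \<circ> (\<lambda>k. k * int M)) has_sum midpoint_rule M g) UNIV"
    using assms(2) by (intro has_sum_reindex) (auto simp: inj_on_def)
  also have "?F \<circ> (\<lambda>k. k * int M) = ?G"
    using assms(2) by (auto simp: fun_eq_iff)
  finally have "(?G has_sum midpoint_rule M g) UNIV" .
  \<comment> \<open>The term of \<open>?G\<close> at 0 is the exact integral; removing it leaves the
    error.\<close>
  moreover have "(?G has_sum fourier_coeff g 0) {0}"
    using has_sum_finite[of "{0}" ?G] by simp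
  ultimately show ?thesis
    by (rule has_sum_Diff) simp
qed

end
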